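(* Let $d,n\geq 1$ be integers, let $\mathcal{H}=\mathbb{C}^d$, and let $(X,\omega)$ be a symmetric weighted design for $S_n$ (acting on $\mathcal{H}^{\otimes n}$). Then $$\frac{1}{n}H(\omega)\geq \log(d)-2d\,\frac{\log(n+1)}{n},$$ where $H(\omega)$ is the Shannon entropy of the weight function $\omega$.
   Context: $\log$ is the base 2 logarithm. The Shannon entropy of a probability distribution $p$ on a finite set $\mathcal{X}$ is $H(p)=-\sum_{x\in\mathcal{X}}p(x)\log p(x)$ (with $0\log 0=0$). The weight function $\omega$ is regarded as a probability distribution on $S_n$ by setting $\omega(\pi)=0$ for $\pi\notin X$. $S_n$ is the group of all permutations of $\{1,\dots,n\}$. For $\pi\in S_n$, $U^{\pi}$ is the unitary on $(\mathbb{C}^d)^{\otimes n}$ defined by $U^{\pi}(x_1\otimes\cdots\otimes x_n)=x_{\pi(1)}\otimes\cdots\otimes x_{\pi(n)}$ for $x_1,\dots,x_n\in\mathbb{C}^d$. $\mathcal{L}(\mathcal{H}^{\otimes n})$ denotes the linear operators on $\mathcal{H}^{\otimes n}$. Definition (symmetric weighted design, or weighted design for $S_n$): let $X\subset S_n$ and let $\omega:X\to\mathbb{R}^+$ be a weight function, i.e. $\omega(\pi)>0$ for all $\pi\in X$ and $\sum_{\pi\in X}\omega(\pi)=1$. The pair $(X,\omega)$ is a symmetric weighted design if $$\frac{1}{n!}\sum_{\pi\in S_n}U^{\pi}\eta\,{U^{\pi}}^{\dagger}=\sum_{\pi\in X}\omega(\pi)\,U^{\pi}\eta\,{U^{\pi}}^{\dagger}\quad\text{for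 all }\eta\in\mathcal{L}(\mathcal{H}^{\otimes n}).$$ *)

theory Defs
  imports "HOL-Analysis.Analysis" "HOL-Combinatorics.Permutations"
begin

text \<open>
  The positions \<open>1, \<dots>, n\<close> are rendered by a finite index type \<open>'n\<close> and the Hilbert space
  \<open>\<complex>\<^sup>d\<close> by \<open>complex ^ 'd\<close>, so \<open>n = CARD('n)\<close> and \<open>d = CARD('d)\<close> (both at least 1, since types
  are nonempty).  The product basis of \<open>(\<complex>\<^sup>d)\<^sup>\<otimes>\<^sup>n\<close> is indexed by functions \<open>'n \<Rightarrow> 'd\<close>, and
  operators on the tensor power are given by their matrices in that basis.
\<close>

type_synonym ('n, 'd) tensor_power = "complex ^ ('n \<Rightarrow> 'd)"
type_synonym ('n, 'd) tensor_operator = "complex ^ ('n \<Rightarrow> 'd) ^ ('n \<Rightarrow> 'd)"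

definition pure_tensor :: "('n::finite \<Rightarrow> complex ^ 'd::finite) \<Rightarrow> ('n, 'd) tensor_power" where
  "pure_tensor x = (\<chi> f. \<Prod>i\<in>UNIV. x i $ f i)"

abbreviation symmetric_group :: "('n::finite \<Rightarrow> 'n) set" where
  "symmetric_group \<equiv> {\<pi>. \<pi> permutes UNIV}"

text \<open>Well-defined for every permutation, see \<open>ex1_perm_unitary\<close> below.\<close>

definition perm_unitary :: "('n::finite \<Rightarrow> 'n) \<Rightarrow> ('n, 'd::finite) tensor_operator" where
  "perm_unitary \<pi> =
    (THE U. \<forall>x :: 'n \<Rightarrow> complex ^ 'd. U *v pure_tensor x = pure_tensor (\<lambda>i. x (\<pi> i)))"

definition hermitian_adjoint :: "complex ^ 'b ^ 'a \<Rightarrow> complex ^ 'a ^ 'b" where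
  "hermitian_adjoint A = (\<chi> i j. cnj (A $ j $ i))"

text \<open>
  The type argument carries the local dimension \<open>d\<close>, which occurs in the defining condition
  but not in the type of \<open>(X, \<omega>)\<close>.  Values of \<open>\<omega>\<close> outside \<open>X\<close> are irrelevant.
\<close>

definition symmetric_weighted_design ::
    "'d::finite itself \<Rightarrow> ('n::finite \<Rightarrow> 'n) set \<Rightarrow> (('n \<Rightarrow> 'n) \<Rightarrow> real) \<Rightarrow> bool" where
  "symmetric_weighted_design _ X \<omega> \<longleftrightarrow>
     X \<subseteq> symmetric_group \<and> (\<forall>\<pi>\<in>X. \<omega> \<pi> > 0) \<and> (\<Sum>\<pi>\<in>X. \<omega> \<pi>) = 1 \<and>
     (\<forall>\<eta> :: ('n, 'd) tensor_operator.
        (1 / fact CARD('n)) *\<^sub>R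
          (\<Sum>\<pi>\<in>symmetric_group. perm_unitary \<pi> ** \<eta> ** hermitian_adjoint (perm_unitary \<pi>)) =
        (\<Sum>\<pi>\<in>X. \<omega> \<pi> *\<^sub>R
          (perm_unitary \<pi> ** \<eta> ** hermitian_adjoint (perm_unitary \<pi>))))"

text \<open>The convention \<open>0 log 0 = 0\<close> holds automatically.\<close>

definition shannon_entropy :: "'a set \<Rightarrow> ('a \<Rightarrow> real) \<Rightarrow> real" where
  "shannon_entropy A p = - (\<Sum>x\<in>A. p x * log 2 (p x))"

definition zero_extension :: "'a set \<Rightarrow> ('a \<Rightarrow> real) \<Rightarrow> 'a \<Rightarrow> real" where
  "zero_extension X w x = (if x \<in> X then w x else 0)"

lemma pure_tensor_axis:
  "pure_tensor (\<lambda>i. axis (g i) 1) = (axis g 1 :: ('n::finite, 'd::finite) tensor_power)"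
proof -
  have "(\<Prod>i\<in>UNIV. (axis (g i) 1 :: complex ^ 'd) $ f i) = (if g = f then 1 else 0)" for f
  proof (cases "g = f")
    case False
    then obtain i where "g i \<noteq> f i" by blast
    then show ?thesis using False by (auto simp: axis_def intro!: prod_zero)
  qed (simp add: axis_def)
  then show ?thesis by (auto simp: pure_tensor_def vec_eq_iff axis_def)
qed

lemma permutation_matrix_pure_tensor:
  fixes x :: "'n::finite \<Rightarrow> complex ^ 'd::finite"
  assumes "\<pi> permutes UNIV"
  shows "(\<chi> f g. if f = g \<circ> \<pi> then 1 else 0) *v pure_tensor x = pure_tensor (\<lambda>i. x (\<pi> i))"
proof -
  have "(\<Sum>g\<in>UNIV. (if f = g \<circ> \<pi> then 1 else 0) * (\<Prod>i\<in>UNIV. x i $ g i)) =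
      (\<Prod>i\<in>UNIV. x (\<pi> i) $ f i)" for f :: "'n \<Rightarrow> 'd"
  proof -
    have eq: "f = g \<circ> \<pi> \<longleftrightarrow> g = f \<circ> inv \<pi>" for g
      by (metis assms comp_assoc comp_id permutes_inv_o)
    have "(\<Sum>g\<in>UNIV. (if f = g \<circ> \<pi> then 1 else 0) * (\<Prod>i\<in>UNIV. x i $ g i)) =
        (\<Sum>g\<in>UNIV. if g = f \<circ> inv \<pi> then (\<Prod>i\<in>UNIV. x i $ g i) else 0)"
      by (intro sum.cong) (auto simp: eq)
    also have "\<dots> = (\<Prod>i\<in>UNIV. x i $ f (inv \<pi> i))" by simp
    also have "\<dots> = (\<Prod>i\<in>UNIV. x (\<pi> i) $ f i)"
      by (rule prod.reindex_bij_witness[of _ \<pi> "inv \<pi>"])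
        (simp_all add: permutes_inverses[OF assms])
    finally show ?thesis .
  qed
  then show ?thesis by (simp add: vec_eq_iff matrix_vector_mult_def pure_tensor_def)
qed

lemma ex1_perm_unitary:
  fixes \<pi> :: "'n::finite \<Rightarrow> 'n"
  assumes "\<pi> permutes UNIV"
  shows "\<exists>!U :: ('n, 'd::finite) tensor_operator.
    \<forall>x. U *v pure_tensor x = pure_tensor (\<lambda>i. x (\<pi> i))"
proof (rule ex_ex1I)
  show "\<exists>U :: ('n, 'd) tensor_operator. \<forall>x. U *v pure_tensor x = pure_tensor (\<lambda>i. x (\<pi> i))"
    using permutation_matrix_pure_tensor[OF assms] by blast
next
  fix U V :: "('n, 'd) tensor_operator"
  assume U: "\<forall>x. U *v pure_tensor x = pure_tensor (\<lambda>i. x (\<pi> i))"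
    and V: "\<forall>x. V *v pure_tensor x = pure_tensor (\<lambda>i. x (\<pi> i))"
  have "U *v axis g 1 = V *v axis g 1" for g
    unfolding pure_tensor_axis[symmetric] by (simp add: U V)
  moreover have "(M *v axis g 1) $ f = M $ f $ g" for M :: "('n, 'd) tensor_operator" and f g
    by (simp add: matrix_vector_mult_def axis_def if_distrib cong: if_cong)
  ultimately show "U = V" by (metis vec_eq_iff)
qed

lemma perm_unitary_pure_tensor:
  assumes "\<pi> permutes UNIV"
  shows "perm_unitary \<pi> *v pure_tensor x = pure_tensor (\<lambda>i. x (\<pi> i))"
  unfolding perm_unitary_def using theI'[OF ex1_perm_unitary[OF assms]] by blast

lemma perm_unitary_eq:
  assumes "\<pi> permutes UNIV"
  shows "perm_unitary \<pi> = (\<chi> f g. if f = g \<circ> \<pi> then 1 else 0)"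
  unfolding perm_unitary_def
  by (rule the1_equality[OF ex1_perm_unitary[OF assms]])
    (simp add: permutation_matrix_pure_tensor[OF assms])

lemma perm_unitary_is_unitary:
  fixes \<pi> :: "'n::finite \<Rightarrow> 'n"
  assumes "\<pi> permutes UNIV"
  shows "hermitian_adjoint (perm_unitary \<pi> :: ('n, 'd::finite) tensor_operator) ** perm_unitary \<pi> = mat 1"
proof -
  have eq: "f \<circ> \<pi> = g \<circ> \<pi> \<longleftrightarrow> f = g" for f g :: "'n \<Rightarrow> 'd"
  proof
    assume "f \<circ> \<pi> = g \<circ> \<pi>"
    then have "f \<circ> (\<pi> \<circ> inv \<pi>) = g \<circ> (\<pi> \<circ> inv \<pi>)" by (simp only: comp_assoc[symmetric])
    then show "f = g" by (simp add: permutes_inv_o[OF assms])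
  qed simp
  have "(\<Sum>h\<in>UNIV. cnj (if h = f \<circ> \<pi> then 1 else 0) * (if h = g \<circ> \<pi> then 1 else 0)) =
      (if f = g then 1 else (0::complex))" for f g :: "'n \<Rightarrow> 'd"
  proof -
    have "(\<Sum>h\<in>UNIV. cnj (if h = f \<circ> \<pi> then 1 else 0) * (if h = g \<circ> \<pi> then 1 else 0)) =
        (\<Sum>h\<in>UNIV. if h = f \<circ> \<pi> then (if f = g then 1 else 0) else (0::complex))"
      by (intro sum.cong) (auto simp: eq)
    then show ?thesis by simp
  qed
  then show ?thesis
    by (simp add: perm_unitary_eq[OF assms] hermitian_adjoint_def matrix_matrix_mult_def
        mat_def vec_eq_iff)
qed

end

theory Submission
  imports Defs
begin

text \<open>
  Applying the design condition to the matrix unit at \<open>(f, f)\<close>, for a word \<open>f\<close> of length \<open>n\<close>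
  over \<open>d\<close> letters, and reading off the diagonal entry at \<open>g\<close> shows that the image of \<open>\<omega>\<close> under
  \<open>\<pi> \<mapsto> f \<circ> \<pi>\<close> is uniform on the orbit of \<open>f\<close>.  Hence no weight exceeds the inverse of the
  orbit size \<open>M\<close>, and \<open>H(\<omega>) \<ge> log M\<close>.  Orbits are classified by their letter counts, so there
  are at most \<open>(n + 1)\<^sup>d\<close> of them, and some orbit has at least \<open>d\<^sup>n / (n + 1)\<^sup>d\<close> elements.
\<close>

text \<open>Right composition is the action on basis labels: \<open>perm_unitary \<pi>\<close> sends
  \<open>axis f 1\<close> to \<open>axis (f \<circ> \<pi>) 1\<close>.\<close>

definition orbit_of :: "('n::finite \<Rightarrow> 'd) \<Rightarrow> ('n \<Rightarrow> 'd) set" where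
  "orbit_of f = (\<lambda>\<pi>. f \<circ> \<pi>) ` symmetric_group"

text \<open>Equal counts mean that both words have the same multiset of letters, and two functions
  with the same image multiset differ by a permutation of their domain.\<close>

lemma same_letter_counts_imp_orbit:
  fixes f g :: "'n::finite \<Rightarrow> 'd"
  assumes "\<And>j. card (f -` {j}) = card (g -` {j})"
  shows "g \<in> orbit_of f"
proof -
  have "image_mset g (mset_set UNIV) = image_mset f (mset_set UNIV)"
    using assms by (intro multiset_eqI) (simp add: count_image_mset vimage_def)
  then obtain p where "p permutes UNIV" "\<And>x. g x = f (p x)"
    using image_mset_eq_implies_permutes[of UNIV g f] by auto
  then show ?thesis
    by (auto simp: orbit_of_def image_iff fun_eq_iff intro!: exI[of _ p])
qed

text \<open>Pigeonhole on the map from words to letter counts: some fiber is at least of average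
  size, and it lies inside a single orbit. The product form avoids division in
  \<open>nat\<close>.\<close>

lemma large_orbit:
  "\<exists>f :: 'n::finite \<Rightarrow> 'd::finite.
     CARD('d) ^ CARD('n) \<le> card (orbit_of f) * (CARD('n) + 1) ^ CARD('d)"
proof -
  define counts where "counts = (\<lambda>(f :: 'n \<Rightarrow> 'd) j. card (f -` {j}))"
  \<comment> \<open>Each of the \<open>CARD('d)\<close> counts takes one of the values 0 to n. That
    they sum to n is ignored, which gives the crude bound (n + 1)^d.\<close>
  define T where "T = (UNIV :: 'd set) \<rightarrow>\<^sub>E {..CARD('n)}"
  have "counts \<in> UNIV \<rightarrow> T"
    by (auto simp: T_def counts_def PiE_def intro!: card_mono)
  moreover have "finite T" "T \<noteq> {}"
    by (auto simp: T_def PiE_eq_empty_iff intro: finite_PiE)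
  ultimately obtain y where y: "card (counts -` {y} \<inter> UNIV) * card T \<ge> CARD('n \<Rightarrow> 'd)"
    using pigeonhole_card[of counts UNIV T] by auto
  \<comment> \<open>Positivity forces the large fiber to be nonempty, so that \<open>y\<close> is
    the count function of an actual word.\<close>
  have "CARD('n \<Rightarrow> 'd) > 0" by (simp add: card_gt_0_iff)
  with y obtain f where f: "counts f = y"
    by (metis (no_types, lifting) card.empty disjoint_iff_not_equal less_le_trans mult_0
        not_less_zero vimage_singleton_eq)
  have "counts -` {y} \<subseteq> orbit_of f"
  proof
    fix g assume "g \<in> counts -` {y}"
    then show "g \<in> orbit_of f"
      using f by (intro same_letter_counts_imp_orbit) (auto simp: counts_def fun_eq_iff)
  qed
  then have "card (counts -` {y}) \<le> card (orbit_of f)" by (intro card_mono) auto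
  then have "card (counts -` {y}) * card T \<le> card (orbit_of f) * card T" by simp
  moreover have "card T = (CARD('n) + 1) ^ CARD('d)" by (simp add: T_def card_PiE)
  moreover have "CARD('n \<Rightarrow> 'd) = CARD('d) ^ CARD('n)" by (simp add: card_fun)
  ultimately have "CARD('d) ^ CARD('n) \<le> card (orbit_of f) * (CARD('n) + 1) ^ CARD('d)"
    using y by (metis inf_top.right_neutral le_trans)
  then show ?thesis by blast
qed

text \<open>Orbit-stabilizer: the fibers of \<open>\<pi> \<mapsto> f \<circ> \<pi>\<close> over the
  orbit are cosets of the stabilizer of \<open>f\<close>, hence equinumerous, and they partition the
  group.\<close>

lemma card_orbit_fiber:
  fixes f g :: "'n::finite \<Rightarrow> 'd"
  assumes "g \<in> orbit_of f"
  shows "card (orbit_of f) * card {\<pi> \<in> symmetric_group. f \<circ> \<pi> = g} = fact CARD('n)"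
proof -
  define F where "F h = {\<pi> \<in> symmetric_group. f \<circ> \<pi> = h}" for h
  have le: "card (F h) \<le> card (F k)" if hk: "h \<in> orbit_of f" "k \<in> orbit_of f" for h k
  proof -
    obtain \<sigma> \<tau> where s: "\<sigma> permutes UNIV" "h = f \<circ> \<sigma>" and t: "\<tau> permutes UNIV" "k = f \<circ> \<tau>"
      using hk by (auto simp: orbit_of_def)
    \<comment> \<open>The factor \<open>inv \<sigma> \<circ> \<tau>\<close> moves \<open>h\<close>
      to \<open>k\<close>, so right multiplication by it embeds one fiber into the other; exchanging
      \<open>h\<close> and \<open>k\<close> gives equality of sizes.\<close>
    let ?r = "\<lambda>\<pi>. \<pi> \<circ> (inv \<sigma> \<circ> \<tau>)"
    have p: "inv \<sigma> \<circ> \<tau> permutes UNIV"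
      using s t by (intro permutes_compose permutes_inv)
    have "inj ?r"
      by (rule inj_onI) (metis p comp_assoc comp_id permutes_inv_o(1))
    moreover have "?r ` F h \<subseteq> F k"
    proof safe
      fix \<pi> assume pi: "\<pi> \<in> F h"
      have "f \<circ> ?r \<pi> = h \<circ> inv \<sigma> \<circ> \<tau>" using pi by (auto simp: F_def comp_assoc)
      also have "\<dots> = f \<circ> (\<sigma> \<circ> inv \<sigma>) \<circ> \<tau>" by (simp only: s comp_assoc)
      also have "\<dots> = k" using s t by (simp add: permutes_inv_o)
      finally have "f \<circ> ?r \<pi> = k" .
      moreover have "?r \<pi> permutes UNIV" using p pi by (auto simp: F_def intro: permutes_compose)
      ultimately show "?r \<pi> \<in> F k" by (simp add: F_def)
    qed
    ultimately show ?thesis by (intro card_inj_on_le[of ?r]) (auto intro: inj_on_subset)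
  qed
  have "fact CARD('n) = card (symmetric_group :: ('n \<Rightarrow> 'n) set)"
    using card_permutations[of "UNIV :: 'n set" "CARD('n)"] by simp
  also have "\<dots> = (\<Sum>h\<in>orbit_of f. card (F h))"
    using sum.image_gen[of symmetric_group "\<lambda>_. 1 :: nat" "\<lambda>\<pi>. f \<circ> \<pi>"]
    by (simp add: orbit_of_def F_def)
  also have "\<dots> = (\<Sum>h\<in>orbit_of f. card (F g))"
    using le assms by (intro sum.cong antisym) auto
  also have "\<dots> = card (orbit_of f) * card (F g)" by simp
  finally show ?thesis by (simp add: F_def)
qed

text \<open>Conjugation turns the projector onto the basis vector at \<open>f\<close> into the one
  onto the basis vector at \<open>f \<circ> \<pi>\<close>.\<close>

lemma perm_unitary_conj_matrix_unit:
  fixes f g :: "'n::finite \<Rightarrow> 'd::finite"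
  assumes "\<pi> permutes UNIV"
  shows "(perm_unitary \<pi> ** (\<chi> a b. if a = f \<and> b = f then 1 else 0)
            ** hermitian_adjoint (perm_unitary \<pi>)) $ g $ g = (if f \<circ> \<pi> = g then 1 else 0)"
proof -
  let ?\<eta> = "(\<chi> a b. if a = f \<and> b = f then 1 else 0) :: ('n, 'd) tensor_operator"
  have "(perm_unitary \<pi> ** ?\<eta>) $ g $ b = (if b = f then if g = f \<circ> \<pi> then 1 else 0 else 0)" for b
  proof -
    have "(perm_unitary \<pi> ** ?\<eta>) $ g $ b =
        (\<Sum>a\<in>UNIV. if a = f then if b = f \<and> g = f \<circ> \<pi> then 1 else 0 else 0)"
      unfolding perm_unitary_eq[OF assms] matrix_matrix_mult_def vec_lambda_beta
      by (rule sum.cong) auto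
    then show ?thesis by simp
  qed
  then have "(perm_unitary \<pi> ** ?\<eta> ** hermitian_adjoint (perm_unitary \<pi>)) $ g $ g =
      (\<Sum>b\<in>UNIV. if b = f then if g = f \<circ> \<pi> then 1 else 0 else 0)"
    unfolding matrix_matrix_mult_def[of "_ ** _"] hermitian_adjoint_def vec_lambda_beta
    by (intro sum.cong) (auto simp: perm_unitary_eq[OF assms])
  then show ?thesis by auto
qed

text \<open>In the diagonal entry at \<open>g\<close> of the design identity, the group average
  counts the fiber over \<open>g\<close> and the weighted sum adds up its weights.\<close>

lemma design_weight_fiber:
  fixes X :: "('n::finite \<Rightarrow> 'n) set" and f g :: "'n \<Rightarrow> 'd::finite"
  assumes "symmetric_weighted_design TYPE('d) X \<omega>"
  shows "(\<Sum>\<pi> | \<pi> \<in> X \<and> f \<circ> \<pi> = g. \<omega> \<pi>) =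
    card {\<pi> \<in> symmetric_group. f \<circ> \<pi> = g} / fact CARD('n)"
proof -
  let ?\<eta> = "(\<chi> a b. if a = f \<and> b = f then 1 else 0) :: ('n, 'd) tensor_operator"
  let ?C = "\<lambda>\<pi>. perm_unitary \<pi> ** ?\<eta> ** hermitian_adjoint (perm_unitary \<pi>)"
  have X: "X \<subseteq> symmetric_group" and
    "(1 / fact CARD('n)) *\<^sub>R (\<Sum>\<pi>\<in>symmetric_group. ?C \<pi>) = (\<Sum>\<pi>\<in>X. \<omega> \<pi> *\<^sub>R ?C \<pi>)"
    using assms unfolding symmetric_weighted_design_def by blast+
  then have "((1 / fact CARD('n)) *\<^sub>R (\<Sum>\<pi>\<in>symmetric_group. ?C \<pi>)) $ g $ g =
      (\<Sum>\<pi>\<in>X. \<omega> \<pi> *\<^sub>R ?C \<pi>) $ g $ g" by simp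
  then have "(1 / fact CARD('n)) *\<^sub>R (\<Sum>\<pi>\<in>symmetric_group. ?C \<pi> $ g $ g) =
      (\<Sum>\<pi>\<in>X. \<omega> \<pi> *\<^sub>R ?C \<pi> $ g $ g)" by (simp add: sum_component)
  moreover have "(\<Sum>\<pi>\<in>symmetric_group. ?C \<pi> $ g $ g) =
      (\<Sum>\<pi>\<in>symmetric_group. if f \<circ> \<pi> = g then 1 else 0)"
    by (intro sum.cong) (simp_all add: perm_unitary_conj_matrix_unit)
  moreover have "(\<Sum>\<pi>\<in>X. \<omega> \<pi> *\<^sub>R ?C \<pi> $ g $ g) =
      (\<Sum>\<pi>\<in>X. complex_of_real (if f \<circ> \<pi> = g then \<omega> \<pi> else 0))"
    using X by (intro sum.cong) (auto simp: perm_unitary_conj_matrix_unit scaleR_conv_of_real)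
  moreover have "{\<pi> \<in> symmetric_group. f \<circ> \<pi> = g} = symmetric_group \<inter> {\<pi>. f \<circ> \<pi> = g}" by blast
  \<comment> \<open>Both sides are put under \<open>complex_of_real\<close>, whose injectivity
    yields the real identity.\<close>
  ultimately have "complex_of_real (card {\<pi> \<in> symmetric_group. f \<circ> \<pi> = g} / fact CARD('n)) =
      complex_of_real (\<Sum>\<pi>\<in>X. if f \<circ> \<pi> = g then \<omega> \<pi> else 0)"
    by (simp only: of_real_sum) (simp add: scaleR_conv_of_real sum.If_cases[of symmetric_group])
  then show ?thesis
    by (simp only: of_real_eq_iff) (simp add: sum.inter_filter)
qed

text \<open>The fiber containing \<open>\<pi>\<close> has total weight 1/M, where M is the orbit
  size, and \<open>\<omega> \<pi>\<close> is one of its positive summands.\<close>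

lemma design_weight_le:
  fixes X :: "('n::finite \<Rightarrow> 'n) set" and f :: "'n \<Rightarrow> 'd::finite"
  assumes design: "symmetric_weighted_design TYPE('d) X \<omega>" and "\<pi> \<in> X"
  shows "\<omega> \<pi> \<le> 1 / card (orbit_of f)"
proof -
  have X: "X \<subseteq> symmetric_group" and pos: "\<And>\<pi>. \<pi> \<in> X \<Longrightarrow> \<omega> \<pi> > 0"
    using design unfolding symmetric_weighted_design_def by blast+
  let ?g = "f \<circ> \<pi>" and ?M = "card (orbit_of f)"
  define c where "c = card {\<sigma> \<in> symmetric_group. f \<circ> \<sigma> = ?g}"
  have "?M * c = fact CARD('n)"
    using X \<open>\<pi> \<in> X\<close> unfolding c_def by (intro card_orbit_fiber) (auto simp: orbit_of_def)
  then have "fact CARD('n) = real ?M * real c" by (metis of_nat_fact of_nat_mult)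
  moreover have "c > 0" using X \<open>\<pi> \<in> X\<close> by (auto simp: c_def card_gt_0_iff)
  ultimately have "c / fact CARD('n) = 1 / ?M" by simp
  moreover have "\<omega> \<pi> \<le> (\<Sum>\<sigma> | \<sigma> \<in> X \<and> f \<circ> \<sigma> = ?g. \<omega> \<sigma>)"
    using pos \<open>\<pi> \<in> X\<close> by (intro member_le_sum) (auto intro: less_imp_le)
  ultimately show ?thesis by (simp only: design_weight_fiber[OF design] c_def)
qed

text \<open>Entropy is the mean of \<open>- log 2 (p x)\<close>, which is at least
  \<open>log 2 M\<close> wherever \<open>p x\<close> is positive.\<close>

lemma shannon_entropy_ge:
  assumes nonneg: "\<And>x. x \<in> A \<Longrightarrow> p x \<ge> 0" and sum: "(\<Sum>x\<in>A. p x) = 1"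
    and le: "\<And>x. x \<in> A \<Longrightarrow> p x \<le> 1 / M" and "M > 0"
  shows "shannon_entropy A p \<ge> log 2 M"
proof -
  have "p x * log 2 (p x) \<le> p x * - log 2 M" if "x \<in> A" for x
  \<comment> \<open>Monotonicity of the logarithm is applied to positive mass only; at mass zero
    both sides vanish.\<close>
  proof (cases "p x = 0")
    case False
    then have "p x > 0" using nonneg[OF that] by simp
    then have "log 2 (p x) \<le> log 2 (1 / M)"
      using le[OF that] \<open>M > 0\<close> by (subst log_le_cancel_iff) auto
    then show ?thesis
      using \<open>p x > 0\<close> \<open>M > 0\<close> by (intro mult_left_mono) (auto simp: log_divide)
  qed simp
  then have "(\<Sum>x\<in>A. p x * log 2 (p x)) \<le> (\<Sum>x\<in>A. p x * - log 2 M)" by (rule sum_mono)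
  also have "\<dots> = - log 2 M" using sum by (simp add: sum_negf flip: sum_distrib_right)
  finally show ?thesis by (simp add: shannon_entropy_def)
qed

theorem theorem5:
  fixes X :: "('n::finite \<Rightarrow> 'n) set" and \<omega> :: "('n \<Rightarrow> 'n) \<Rightarrow> real" and d n :: nat
  assumes "CARD('d::finite) = d" and "CARD('n) = n"
    and "symmetric_weighted_design TYPE('d) X \<omega>"
  shows "1 / real n * shannon_entropy symmetric_group (zero_extension X \<omega>)
           \<ge> log 2 (real d) - 2 * real d * (log 2 (real (n + 1)) / real n)"
proof -
  have pos: "d > 0" "n > 0" using assms(1,2) by (auto simp: card_gt_0_iff)
  have X: "X \<subseteq> symmetric_group" "\<And>\<pi>. \<pi> \<in> X \<Longrightarrow> \<omega> \<pi> > 0" "(\<Sum>\<pi>\<in>X. \<omega> \<pi>) = 1"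
    using assms(3) unfolding symmetric_weighted_design_def by blast+
  obtain f :: "'n \<Rightarrow> 'd" where f: "d ^ n \<le> card (orbit_of f) * (n + 1) ^ d"
    using large_orbit assms(1,2) by blast
  let ?M = "real (card (orbit_of f))"
  have M: "?M > 0"
    using f pos by (intro of_nat_0_less_iff[THEN iffD2] gr0I) auto
  have "real d ^ n \<le> ?M * real (n + 1) ^ d"
    using of_nat_mono[OF f, where 'a = real] by simp
  then have "log 2 (real d ^ n) \<le> log 2 (?M * real (n + 1) ^ d)"
    by (rule log_mono[rotated 2]) (use pos in auto)
  also have "\<dots> = log 2 ?M + d * log 2 (n + 1)"
    using M by (subst log_mult_pos) (auto simp: log_nat_power)
  finally have "n * log 2 d - d * log 2 (n + 1) \<le> log 2 ?M"
    using pos by (simp add: log_nat_power)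
  also have "\<dots> \<le> shannon_entropy symmetric_group (zero_extension X \<omega>)"
  proof (rule shannon_entropy_ge)
    have "sum (zero_extension X \<omega>) symmetric_group = sum (zero_extension X \<omega>) X"
      using X(1) by (intro sum.mono_neutral_right) (auto simp: zero_extension_def)
    then show "sum (zero_extension X \<omega>) symmetric_group = 1"
      using X(3) by (simp add: zero_extension_def)
  qed (use X M design_weight_le[OF assms(3)] in \<open>auto simp: zero_extension_def less_imp_le\<close>)
  finally have H: "n * log 2 d - d * log 2 (n + 1) \<le>
      shannon_entropy symmetric_group (zero_extension X \<omega>)" .
  \<comment> \<open>The estimate \<open>H\<close> subtracts this term once; subtracting it a second
    time gives the factor 2 of the claim.\<close>
  have "d * log 2 (n + 1) \<ge> 0" by simp
  with H have "n * log 2 d - 2 * d * log 2 (n + 1) \<le>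
      shannon_entropy symmetric_group (zero_extension X \<omega>)" by linarith
  then have "1 / n * (n * log 2 d - 2 * d * log 2 (n + 1)) \<le>
      1 / n * shannon_entropy symmetric_group (zero_extension X \<omega>)"
    by (rule mult_left_mono) simp
  then show ?thesis using pos by (simp add: field_simps)
qed

end
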